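(* Let $A,B$ be finitely generated algebras in a congruence permutable variety $\mathcal{V}$, and let $C\leq A\times B$ be a subdirect product of $A$ and $B$, with projections $\pi_A\colon C\to A$ and $\pi_B\colon C\to B$. Let $\lambda_A:=\pi_A(\ker\pi_A\vee\ker\pi_B)$ and $\lambda_B:=\pi_B(\ker\pi_A\vee\ker\pi_B)$. If $\lambda_B$ is a finitely generated congruence on $B$ (or $\lambda_A$ is a finitely generated congruence on $A$), then $C$ is finitely generated.
   Context: A variety is a class of algebras of the same type defined by equations; it is congruence permutable if $\alpha\circ\beta=\beta\circ\alpha$ for all congruences $\alpha,\beta$ of every algebra in it. A subdirect product of $A$ and $B$ is a subalgebra $C\leq A\times B$ whose projections onto $A$ and onto $B$ are both surjective. The kernels $\ker\pi_A,\ker\pi_B$ are congruences of $C$, and $\vee$ is the join in the congruence lattice of $C$. For a congruence $\theta$ of $C$, $\pi_X(\theta)=\{(\pi_X(c),\pi_X(c')) : (c,c')\in\theta\}$ for $X\in\{A,B\}$; $\lambda_A$ and $\lambda_B$ are congruences of $A$ and $B$. A congruence is finitely generated if it is the smallest congruence containing some finite set of pairs. *)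

theory Defs
  imports Main
begin

record 'f signature =
  ops :: "'f set"
  arity :: "'f \<Rightarrow> nat"

(* Only the values of oper A f on lists over carrier A of length arity S f, for f in ops S,
   are meaningful; everything below depends on these values alone. *)
record ('f, 'a) algebra =
  carrier :: "'a set"
  oper :: "'f \<Rightarrow> 'a list \<Rightarrow> 'a"

(* The empty carrier is allowed (it occurs only if there are no constants), so that the notions
   cover both conventions on empty algebras. *)
definition closed_under_ops :: "'f signature \<Rightarrow> ('f, 'a) algebra \<Rightarrow> 'a set \<Rightarrow> bool" where
  "closed_under_ops S A X \<longleftrightarrow>
     (\<forall>f\<in>ops S. \<forall>xs. length xs = arity S f \<longrightarrow> set xs \<subseteq> X \<longrightarrow> oper A f xs \<in> X)"

definition is_algebra :: "'f signature \<Rightarrow> ('f, 'a) algebra \<Rightarrow> bool" where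
  "is_algebra S A \<longleftrightarrow> closed_under_ops S A (carrier A)"

datatype ('f, 'x) trm = Var 'x | App 'f "('f, 'x) trm list"

fun wf_trm :: "'f signature \<Rightarrow> ('f, 'x) trm \<Rightarrow> bool" where
  "wf_trm S (Var x) \<longleftrightarrow> True"
| "wf_trm S (App f ts) \<longleftrightarrow>
     f \<in> ops S \<and> length ts = arity S f \<and> (\<forall>t\<in>set ts. wf_trm S t)"

fun eval_trm :: "('f, 'a) algebra \<Rightarrow> ('x \<Rightarrow> 'a) \<Rightarrow> ('f, 'x) trm \<Rightarrow> 'a" where
  "eval_trm A v (Var x) = v x"
| "eval_trm A v (App f ts) = oper A f (map (eval_trm A v) ts)"

type_synonym 'f equations = "(('f, nat) trm \<times> ('f, nat) trm) set"

definition are_equations :: "'f signature \<Rightarrow> 'f equations \<Rightarrow> bool" where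
  "are_equations S E \<longleftrightarrow> (\<forall>(s, t)\<in>E. wf_trm S s \<and> wf_trm S t)"

(* A variety is represented by its signature S and a set E of defining equations, because the
   class of all its members ranges over all carrier types. *)
definition in_variety :: "'f signature \<Rightarrow> 'f equations \<Rightarrow> ('f, 'a) algebra \<Rightarrow> bool" where
  "in_variety S E A \<longleftrightarrow> is_algebra S A \<and>
     (\<forall>(s, t)\<in>E. \<forall>v. range v \<subseteq> carrier A \<longrightarrow> eval_trm A v s = eval_trm A v t)"

definition congruence :: "'f signature \<Rightarrow> ('f, 'a) algebra \<Rightarrow> ('a \<times> 'a) set \<Rightarrow> bool" where
  "congruence S A \<theta> \<longleftrightarrow> equiv (carrier A) \<theta> \<and>
     (\<forall>f\<in>ops S. \<forall>xs ys. length xs = arity S f \<longrightarrow> list_all2 (\<lambda>x y. (x, y) \<in> \<theta>) xs ys \<longrightarrow>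
        (oper A f xs, oper A f ys) \<in> \<theta>)"

definition congruence_generated ::
  "'f signature \<Rightarrow> ('f, 'a) algebra \<Rightarrow> ('a \<times> 'a) set \<Rightarrow> ('a \<times> 'a) set" where
  "congruence_generated S A R = \<Inter>{\<theta>. congruence S A \<theta> \<and> R \<subseteq> \<theta>}"

definition congruence_join ::
  "'f signature \<Rightarrow> ('f, 'a) algebra \<Rightarrow> ('a \<times> 'a) set \<Rightarrow> ('a \<times> 'a) set \<Rightarrow> ('a \<times> 'a) set" where
  "congruence_join S A \<alpha> \<beta> = congruence_generated S A (\<alpha> \<union> \<beta>)"

definition fin_gen_congruence ::
  "'f signature \<Rightarrow> ('f, 'a) algebra \<Rightarrow> ('a \<times> 'a) set \<Rightarrow> bool" where
  "fin_gen_congruence S A \<theta> \<longleftrightarrow>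
     (\<exists>R. finite R \<and> R \<subseteq> carrier A \<times> carrier A \<and> \<theta> = congruence_generated S A R)"

(* HOL cannot quantify over all carrier types inside a formula, so "every algebra of the variety"
   becomes "every algebra of the variety with elements in the universe 'u".  By Maltsev's theorem
   this is equivalent to permutability of all members as soon as 'u has room for a copy of the
   free algebra on three generators.  For a small 'u, such as unit, it says nothing. *)
definition congruence_permutable ::
  "'u itself \<Rightarrow> 'f signature \<Rightarrow> 'f equations \<Rightarrow> bool" where
  "congruence_permutable U S E \<longleftrightarrow>
     (\<forall>A :: ('f, 'u) algebra. in_variety S E A \<longrightarrow>
        (\<forall>\<alpha> \<beta>. congruence S A \<alpha> \<longrightarrow> congruence S A \<beta> \<longrightarrow> \<alpha> O \<beta> = \<beta> O \<alpha>))"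

definition generated_subset :: "'f signature \<Rightarrow> ('f, 'a) algebra \<Rightarrow> 'a set \<Rightarrow> 'a set" where
  "generated_subset S A X = \<Inter>{Y. X \<subseteq> Y \<and> Y \<subseteq> carrier A \<and> closed_under_ops S A Y}"

definition fin_gen_algebra :: "'f signature \<Rightarrow> ('f, 'a) algebra \<Rightarrow> bool" where
  "fin_gen_algebra S A \<longleftrightarrow>
     (\<exists>X. finite X \<and> X \<subseteq> carrier A \<and> generated_subset S A X = carrier A)"

definition subalgebra :: "'f signature \<Rightarrow> ('f, 'a) algebra \<Rightarrow> ('f, 'a) algebra \<Rightarrow> bool" where
  "subalgebra S C A \<longleftrightarrow> is_algebra S C \<and> carrier C \<subseteq> carrier A \<and>
     (\<forall>f\<in>ops S. \<forall>xs. length xs = arity S f \<longrightarrow> set xs \<subseteq> carrier C \<longrightarrow>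
        oper C f xs = oper A f xs)"

definition prod_algebra ::
  "('f, 'a) algebra \<Rightarrow> ('f, 'b) algebra \<Rightarrow> ('f, 'a \<times> 'b) algebra" where
  "prod_algebra A B =
     \<lparr>carrier = carrier A \<times> carrier B,
      oper = (\<lambda>f xs. (oper A f (map fst xs), oper B f (map snd xs)))\<rparr>"

definition subdirect_product ::
  "'f signature \<Rightarrow> ('f, 'a \<times> 'b) algebra \<Rightarrow> ('f, 'a) algebra \<Rightarrow> ('f, 'b) algebra \<Rightarrow> bool" where
  "subdirect_product S C A B \<longleftrightarrow> subalgebra S C (prod_algebra A B) \<and>
     fst ` carrier C = carrier A \<and> snd ` carrier C = carrier B"

definition kernel_on :: "('f, 'a) algebra \<Rightarrow> ('a \<Rightarrow> 'b) \<Rightarrow> ('a \<times> 'a) set" where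
  "kernel_on C h = {(c, c') \<in> carrier C \<times> carrier C. h c = h c'}"

definition image_relation :: "('a \<Rightarrow> 'b) \<Rightarrow> ('a \<times> 'a) set \<Rightarrow> ('b \<times> 'b) set" where
  "image_relation h \<theta> = {(h c, h c') | c c'. (c, c') \<in> \<theta>}"

definition lambda_fst ::
  "'f signature \<Rightarrow> ('f, 'a \<times> 'b) algebra \<Rightarrow> ('a \<times> 'a) set" where
  "lambda_fst S C = image_relation fst (congruence_join S C (kernel_on C fst) (kernel_on C snd))"

definition lambda_snd ::
  "'f signature \<Rightarrow> ('f, 'a \<times> 'b) algebra \<Rightarrow> ('b \<times> 'b) set" where
  "lambda_snd S C = image_relation snd (congruence_join S C (kernel_on C fst) (kernel_on C snd))"

lemma congruence_full:
  assumes "is_algebra S A"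
  shows "congruence S A (carrier A \<times> carrier A)"
proof -
  have "oper A f xs \<in> carrier A \<and> oper A f ys \<in> carrier A"
    if "f \<in> ops S" "length xs = arity S f"
      "list_all2 (\<lambda>x y. (x, y) \<in> carrier A \<times> carrier A) xs ys" for f xs ys
  proof -
    have "set xs \<subseteq> carrier A" "set ys \<subseteq> carrier A" "length ys = length xs"
      using that(3) by (auto simp: list_all2_conv_all_nth in_set_conv_nth)
    then show ?thesis
      using assms that(1,2) by (auto simp: is_algebra_def closed_under_ops_def)
  qed
  then show ?thesis
    by (auto simp: congruence_def equiv_def refl_on_def sym_def trans_def)
qed

lemma congruence_congruence_generated:
  assumes "is_algebra S A" and "R \<subseteq> carrier A \<times> carrier A"
  shows "congruence S A (congruence_generated S A R)"
proof -
  let ?T = "{\<theta>. congruence S A \<theta> \<and> R \<subseteq> \<theta>}"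
  have full: "carrier A \<times> carrier A \<in> ?T"
    using congruence_full[OF assms(1)] assms(2) by simp
  have "equiv (carrier A) (\<Inter>?T)"
  proof (rule equivI)
    show "\<Inter>?T \<subseteq> carrier A \<times> carrier A"
      using full by blast
    show "refl_on (carrier A) (\<Inter>?T)"
      by (auto simp: congruence_def equiv_def refl_on_def)
    show "sym (\<Inter>?T)"
      by (rule symI) (auto simp: congruence_def equiv_def dest: symD)
    show "trans (\<Inter>?T)"
      by (rule transI) (simp add: congruence_def equiv_def, meson transD)
  qed
  moreover have "(oper A f xs, oper A f ys) \<in> \<Inter>?T"
    if "f \<in> ops S" "length xs = arity S f" "list_all2 (\<lambda>x y. (x, y) \<in> \<Inter>?T) xs ys" for f xs ys
  proof (rule InterI)
    fix \<theta> assume \<theta>: "\<theta> \<in> ?T"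
    have "list_all2 (\<lambda>x y. (x, y) \<in> \<theta>) xs ys"
      using that(3) by (rule list_all2_mono) (use \<theta> in blast)
    then show "(oper A f xs, oper A f ys) \<in> \<theta>"
      using \<theta> that(1,2) by (simp add: congruence_def)
  qed
  ultimately show ?thesis
    by (simp add: congruence_def congruence_generated_def)
qed

end

theory Submission
  imports Defs
begin

text \<open>
  Read a subalgebra \<open>D\<close> of \<open>A \<times> B\<close> as a relation from \<open>A\<close> to \<open>B\<close>. Congruence permutability is used
  only through the fact that every such \<open>D\<close> is difunctional, \<open>D O D\<inverse> O D \<subseteq> D\<close>: if \<open>(a, b)\<close>,
  \<open>(a', b)\<close>, \<open>(a', b')\<close> lie in \<open>D\<close>, then the first and the last are related by the kernel of the
  second projection followed by that of the first, hence also by the two kernels in the other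
  order, and the intermediate element can only be \<open>(a, b')\<close>
  (\<open>subalgebra_of_product_difunctional\<close>).

  Difunctionality makes \<open>D\<inverse> O D\<close> a congruence of \<open>B\<close> whenever \<open>D\<close> projects onto \<open>B\<close>, and for
  \<open>D = C\<close> this congruence is \<open>\<lambda>\<^sub>B\<close>. A subdirect \<open>D \<subseteq> C\<close> with \<open>C\<inverse> O C \<subseteq> D\<inverse> O D\<close> is all of \<open>C\<close>:
  given \<open>(a, b) \<in> C\<close>, choose \<open>(a, b') \<in> D\<close>; then \<open>(b', b) \<in> C\<inverse> O C \<subseteq> D\<inverse> O D\<close>, so
  \<open>(a, b) \<in> D O D\<inverse> O D \<subseteq> D\<close>. Finitely many elements of \<open>C\<close> force \<open>D\<close> to have these properties:
  lifts of generators of \<open>A\<close> and of \<open>B\<close> make \<open>D\<close> subdirect, and for each generating pair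
  \<open>(b, b')\<close> of \<open>\<lambda>\<^sub>B\<close> two elements \<open>(a, b)\<close>, \<open>(a, b')\<close> of \<open>C\<close> put that pair into the congruence
  \<open>D\<inverse> O D\<close>. The case of \<open>\<lambda>\<^sub>A\<close> is the same argument for the converse relation.
\<close>

section \<open>Subalgebras of products as relations\<close>

definition compatible ::
  "'f signature \<Rightarrow> ('f, 'a) algebra \<Rightarrow> ('f, 'b) algebra \<Rightarrow> ('a \<times> 'b) set \<Rightarrow> bool" where
  "compatible S A B D \<longleftrightarrow>
     (\<forall>f\<in>ops S. \<forall>xs ys. length xs = arity S f \<longrightarrow> list_all2 (\<lambda>x y. (x, y) \<in> D) xs ys \<longrightarrow>
        (oper A f xs, oper B f ys) \<in> D)"

lemma compatibleD:
  assumes "compatible S A B D" "f \<in> ops S" "length xs = arity S f"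
    "list_all2 (\<lambda>x y. (x, y) \<in> D) xs ys"
  shows "(oper A f xs, oper B f ys) \<in> D"
  using assms by (simp add: compatible_def)

lemma compatible_iff_closed_under_ops:
  "compatible S A B D \<longleftrightarrow> closed_under_ops S (prod_algebra A B) D"
proof
  assume D: "compatible S A B D"
  have "list_all2 (\<lambda>x y. (x, y) \<in> D) (map fst ps) (map snd ps)" if "set ps \<subseteq> D" for ps
    using that by (induction ps) auto
  then show "closed_under_ops S (prod_algebra A B) D"
    unfolding closed_under_ops_def prod_algebra_def using D by (auto intro!: compatibleD)
next
  assume D: "closed_under_ops S (prod_algebra A B) D"
  show "compatible S A B D"
    unfolding compatible_def
  proof (intro ballI allI impI)
    fix f xs ys
    assume f: "f \<in> ops S" and len: "length xs = arity S f"
      and rel: "list_all2 (\<lambda>x y. (x, y) \<in> D) xs ys"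
    have "length ys = length xs" "set (zip xs ys) \<subseteq> D"
      using rel by (auto simp: list_all2_iff)
    then have "oper (prod_algebra A B) f (zip xs ys) \<in> D"
      using D f len by (simp add: closed_under_ops_def)
    then show "(oper A f xs, oper B f ys) \<in> D"
      using \<open>length ys = length xs\<close> by (simp add: prod_algebra_def)
  qed
qed

lemma compatible_converse:
  assumes "compatible S A B D"
  shows "compatible S B A (D\<inverse>)"
  unfolding compatible_def
proof (intro ballI allI impI)
  fix f ys xs
  assume f: "f \<in> ops S" and len: "length ys = arity S f"
    and rel: "list_all2 (\<lambda>y x. (y, x) \<in> D\<inverse>) ys xs"
  have "list_all2 (\<lambda>x y. (x, y) \<in> D) xs ys" "length xs = arity S f"
    using rel len by (auto simp: list_all2_conv_all_nth)
  then show "(oper B f ys, oper A f xs) \<in> D\<inverse>"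
    using compatibleD[OF assms f] by simp
qed

lemma compatible_relcomp:
  assumes "compatible S A B D" and "compatible S B M D'"
  shows "compatible S A M (D O D')"
  unfolding compatible_def
proof (intro ballI allI impI)
  fix f xs zs
  assume f: "f \<in> ops S" and len: "length xs = arity S f"
    and rel: "list_all2 (\<lambda>x z. (x, z) \<in> D O D') xs zs"
  have "(\<lambda>x z. (x, z) \<in> D O D') = (\<lambda>x y. (x, y) \<in> D) OO (\<lambda>y z. (y, z) \<in> D')"
    by (auto simp: fun_eq_iff)
  then obtain ys where ys: "list_all2 (\<lambda>x y. (x, y) \<in> D) xs ys"
    "list_all2 (\<lambda>y z. (y, z) \<in> D') ys zs"
    using rel by (auto simp: list.rel_compp)
  have "length ys = arity S f"
    using ys(1) len by (simp add: list_all2_lengthD)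
  then show "(oper A f xs, oper M f zs) \<in> D O D'"
    using compatibleD[OF assms(1) f len ys(1)] compatibleD[OF assms(2) f _ ys(2)] by blast
qed

lemma closed_under_ops_Domain:
  assumes "compatible S A B D"
  shows "closed_under_ops S A (Domain D)"
  unfolding closed_under_ops_def
proof (intro ballI allI impI)
  fix f xs
  assume f: "f \<in> ops S" and len: "length xs = arity S f" and xs: "set xs \<subseteq> Domain D"
  have "\<exists>ys. list_all2 (\<lambda>x y. (x, y) \<in> D) xs ys"
    using xs by (induction xs) (auto simp: list_all2_Cons1)
  then show "oper A f xs \<in> Domain D"
    using compatibleD[OF assms f len] by blast
qed

lemma fin_gen_algebra_iff:
  assumes "is_algebra S A"
  shows "fin_gen_algebra S A \<longleftrightarrow>
    (\<exists>X. finite X \<and> X \<subseteq> carrier A \<and>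
      (\<forall>Y. X \<subseteq> Y \<longrightarrow> Y \<subseteq> carrier A \<longrightarrow> closed_under_ops S A Y \<longrightarrow> Y = carrier A))"
proof -
  have "generated_subset S A X = carrier A \<longleftrightarrow>
      (\<forall>Y. X \<subseteq> Y \<longrightarrow> Y \<subseteq> carrier A \<longrightarrow> closed_under_ops S A Y \<longrightarrow> Y = carrier A)"
    if "X \<subseteq> carrier A" for X
  proof -
    let ?F = "{Y. X \<subseteq> Y \<and> Y \<subseteq> carrier A \<and> closed_under_ops S A Y}"
    have "carrier A \<in> ?F"
      using assms that by (simp add: is_algebra_def)
    then have "\<Inter>?F = carrier A \<longleftrightarrow> (\<forall>Y\<in>?F. carrier A \<subseteq> Y)"
      by (metis (no_types, lifting) Inter_greatest Inter_lower subset_antisym)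
    also have "\<dots> \<longleftrightarrow>
        (\<forall>Y. X \<subseteq> Y \<longrightarrow> Y \<subseteq> carrier A \<longrightarrow> closed_under_ops S A Y \<longrightarrow> Y = carrier A)"
      by (metis (no_types, lifting) mem_Collect_eq order_refl subset_antisym)
    finally show ?thesis
      unfolding generated_subset_def .
  qed
  then show ?thesis
    unfolding fin_gen_algebra_def by (simp cong: conj_cong)
qed

section \<open>Congruences and homomorphisms\<close>

definition homomorphism ::
  "'f signature \<Rightarrow> ('f, 'a) algebra \<Rightarrow> ('f, 'b) algebra \<Rightarrow> ('a \<Rightarrow> 'b) \<Rightarrow> bool" where
  "homomorphism S M A h \<longleftrightarrow> h ` carrier M \<subseteq> carrier A \<and>
     (\<forall>f\<in>ops S. \<forall>xs. length xs = arity S f \<longrightarrow> set xs \<subseteq> carrier M \<longrightarrow>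
        h (oper M f xs) = oper A f (map h xs))"

lemma congruence_pullback:
  assumes M: "is_algebra S M" and h: "homomorphism S M A h" and \<theta>: "congruence S A \<theta>"
  shows "congruence S M {(c, c') \<in> carrier M \<times> carrier M. (h c, h c') \<in> \<theta>}"
    (is "congruence S M ?T")
proof -
  have eq: "equiv (carrier A) \<theta>"
    using \<theta> by (simp add: congruence_def)
  have "equiv (carrier M) ?T"
  proof (rule equivI)
    show "refl_on (carrier M) ?T"
      using eq h by (auto simp: equiv_def refl_on_def homomorphism_def)
    show "sym ?T"
      using eq by (auto simp: equiv_def sym_def)
    show "trans ?T"
      using eq unfolding equiv_def trans_def by blast
  qed auto
  moreover have "(oper M f xs, oper M f ys) \<in> ?T"
    if f: "f \<in> ops S" and len: "length xs = arity S f"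
      and rel: "list_all2 (\<lambda>x y. (x, y) \<in> ?T) xs ys" for f xs ys
  proof -
    have sub: "set xs \<subseteq> carrier M" "set ys \<subseteq> carrier M" and len': "length ys = arity S f"
      using rel len by (auto simp: list_all2_conv_all_nth in_set_conv_nth)
    have "list_all2 (\<lambda>x y. (x, y) \<in> \<theta>) (map h xs) (map h ys)"
      using rel by (auto simp: list_all2_conv_all_nth)
    then have "(oper A f (map h xs), oper A f (map h ys)) \<in> \<theta>"
      using \<theta> f len by (simp add: congruence_def)
    then show ?thesis
      using h M f len len' sub
      by (auto simp: homomorphism_def is_algebra_def closed_under_ops_def)
  qed
  ultimately show ?thesis
    by (simp add: congruence_def)
qed

lemma congruence_Id_on:
  assumes "is_algebra S A"
  shows "congruence S A (Id_on (carrier A))"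
proof -
  have "xs = ys \<and> set xs \<subseteq> carrier A"
    if "list_all2 (\<lambda>x y. (x, y) \<in> Id_on (carrier A)) xs ys" for xs ys
    using that by (induction rule: list_all2_induct) auto
  moreover have "equiv (carrier A) (Id_on (carrier A))"
    by (auto intro!: equivI simp: refl_on_def sym_def trans_def)
  ultimately show ?thesis
    using assms unfolding congruence_def is_algebra_def closed_under_ops_def
    by (metis Id_onI)
qed

lemma congruence_kernel_on:
  assumes "is_algebra S M" and "is_algebra S A" and h: "homomorphism S M A h"
  shows "congruence S M (kernel_on M h)"
proof -
  have "kernel_on M h = {(c, c') \<in> carrier M \<times> carrier M. (h c, h c') \<in> Id_on (carrier A)}"
    using h by (auto simp: kernel_on_def homomorphism_def)
  then show ?thesis
    using congruence_pullback[OF assms(1) h congruence_Id_on[OF assms(2)]] by simp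
qed

text \<open>
  The pullback along \<open>h\<close> of the image of \<open>\<alpha>\<close> is a congruence above both \<open>\<alpha>\<close> and the kernel of
  \<open>h\<close>, so joining the kernel to \<open>\<alpha>\<close> adds nothing to the image.
\<close>

lemma image_relation_congruence_join_kernel_on:
  assumes M: "is_algebra S M" and h: "homomorphism S M A h"
    and \<alpha>: "\<alpha> \<subseteq> carrier M \<times> carrier M" and image: "congruence S A (image_relation h \<alpha>)"
  shows "image_relation h (congruence_join S M \<alpha> (kernel_on M h)) = image_relation h \<alpha>"
proof
  let ?T = "{(c, c') \<in> carrier M \<times> carrier M. (h c, h c') \<in> image_relation h \<alpha>}"
  have "kernel_on M h \<subseteq> ?T"
    using image h
    by (auto simp: kernel_on_def congruence_def equiv_def refl_on_def homomorphism_def)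
  moreover have "\<alpha> \<subseteq> ?T"
    using \<alpha> by (auto simp: image_relation_def)
  ultimately have "congruence_join S M \<alpha> (kernel_on M h) \<subseteq> ?T"
    using congruence_pullback[OF M h image]
    unfolding congruence_join_def congruence_generated_def by blast
  then show "image_relation h (congruence_join S M \<alpha> (kernel_on M h)) \<subseteq> image_relation h \<alpha>"
    by (auto simp: image_relation_def[of h "congruence_join S M \<alpha> (kernel_on M h)"])
  have "\<alpha> \<subseteq> congruence_join S M \<alpha> (kernel_on M h)"
    unfolding congruence_join_def congruence_generated_def by blast
  then show "image_relation h \<alpha> \<subseteq> image_relation h (congruence_join S M \<alpha> (kernel_on M h))"
    unfolding image_relation_def by blast
qed

section \<open>Difunctional subalgebras\<close>

text \<open>
  Permutability speaks about algebras on one fixed universe, so the subalgebra is copied into a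
  summand of that universe; there the kernels of its two projections commute, which says that
  \<open>D\<close> is difunctional.
\<close>

lemma subalgebra_of_product_difunctional:
  fixes A :: "('f, 'a) algebra" and B :: "('f, 'b) algebra"
  assumes perm: "congruence_permutable TYPE('t + 'a \<times> 'b) S E"
    and A: "in_variety S E A" and B: "in_variety S E B"
    and D: "compatible S A B D" "D \<subseteq> carrier A \<times> carrier B"
  shows "D O D\<inverse> O D \<subseteq> D"
proof -
  define M :: "('f, 't + 'a \<times> 'b) algebra" where
    "M = \<lparr>carrier = Inr ` D, oper = (\<lambda>f xs. Inr (oper (prod_algebra A B) f (map projr xs)))\<rparr>"
  have carrier_M: "carrier M = Inr ` D"
    by (simp add: M_def)
  have closed: "oper (prod_algebra A B) f ps \<in> D"
    if "f \<in> ops S" "length ps = arity S f" "set ps \<subseteq> D" for f ps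
    using D(1) that unfolding compatible_iff_closed_under_ops closed_under_ops_def by blast
  have alg_M: "is_algebra S M"
    unfolding is_algebra_def closed_under_ops_def
  proof (intro ballI allI impI)
    fix f xs assume f: "f \<in> ops S" "length xs = arity S f" and "set xs \<subseteq> carrier M"
    then have "set (map projr xs) \<subseteq> D"
      by (auto simp: carrier_M)
    then show "oper M f xs \<in> carrier M"
      using closed[of f "map projr xs"] f by (simp add: M_def)
  qed
  have eval_M: "eval_trm M v t =
      Inr (eval_trm A (\<lambda>x. fst (projr (v x))) t, eval_trm B (\<lambda>x. snd (projr (v x))) t)"
    if v: "range v \<subseteq> carrier M" for v :: "nat \<Rightarrow> _" and t
  proof (induction t)
    case (Var x)
    have "v x \<in> Inr ` D"
      using v by (auto simp: carrier_M)
    then show ?case by auto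
  next
    case (App f ts)
    have "oper M f us = Inr (oper A f (map (\<lambda>u. fst (projr u)) us),
        oper B f (map (\<lambda>u. snd (projr u)) us))" for us
      by (simp add: M_def prod_algebra_def comp_def)
    then show ?case
      by (simp add: comp_def App cong: map_cong)
  qed
  have "in_variety S E M"
  proof -
    have "eval_trm M v s = eval_trm M v t" if "(s, t) \<in> E" and v: "range v \<subseteq> carrier M" for s t v
    proof -
      have "range (\<lambda>x. fst (projr (v x))) \<subseteq> carrier A" "range (\<lambda>x. snd (projr (v x))) \<subseteq> carrier B"
        using v D(2) by (fastforce simp: carrier_M)+
      then have "eval_trm A (\<lambda>x. fst (projr (v x))) s = eval_trm A (\<lambda>x. fst (projr (v x))) t"
        "eval_trm B (\<lambda>x. snd (projr (v x))) s = eval_trm B (\<lambda>x. snd (projr (v x))) t"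
        using A B that(1) unfolding in_variety_def by blast+
      then show ?thesis
        using eval_M[OF v] by simp
    qed
    then show ?thesis
      using alg_M unfolding in_variety_def by blast
  qed
  moreover have "homomorphism S M A (fst \<circ> projr)" "homomorphism S M B (snd \<circ> projr)"
    using D(2) by (auto simp: homomorphism_def M_def prod_algebra_def)
  then have "congruence S M (kernel_on M (fst \<circ> projr))"
    "congruence S M (kernel_on M (snd \<circ> projr))"
    using A B alg_M by (auto intro: congruence_kernel_on simp: in_variety_def)
  ultimately have comm: "kernel_on M (snd \<circ> projr) O kernel_on M (fst \<circ> projr)
      = kernel_on M (fst \<circ> projr) O kernel_on M (snd \<circ> projr)"
    using perm unfolding congruence_permutable_def by blast
  have "(a, b') \<in> D" if "(a, b) \<in> D" "(a', b) \<in> D" "(a', b') \<in> D" for a a' b b'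
  proof -
    have "(Inr (a, b), Inr (a', b')) \<in> kernel_on M (snd \<circ> projr) O kernel_on M (fst \<circ> projr)"
      using that by (intro relcompI[of _ "Inr (a', b)"]) (auto simp: kernel_on_def carrier_M)
    then show ?thesis
      unfolding comm by (auto simp: kernel_on_def carrier_M)
  qed
  then show ?thesis
    by blast
qed

lemma congruence_converse_relcomp:
  assumes "compatible S A B D" and "D \<subseteq> carrier A \<times> carrier B" and "Range D = carrier B"
    and "D O D\<inverse> O D \<subseteq> D"
  shows "congruence S B (D\<inverse> O D)"
proof -
  have "equiv (carrier B) (D\<inverse> O D)"
  proof (rule equivI)
    show "D\<inverse> O D \<subseteq> carrier B \<times> carrier B"
      using assms(2) by blast
    show "refl_on (carrier B) (D\<inverse> O D)"
      using assms(3) by (auto simp: refl_on_def)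
    show "sym (D\<inverse> O D)"
      by (auto simp: sym_def)
    show "trans (D\<inverse> O D)"
      using assms(4) unfolding trans_def by blast
  qed
  then show ?thesis
    using compatible_relcomp[OF compatible_converse[OF assms(1)] assms(1)]
    unfolding congruence_def compatible_def by blast
qed

text \<open>
  Permutability enters only as difunctionality of all subalgebras, a hypothesis that is invariant
  under exchanging \<open>A\<close> with \<open>B\<close> and relations with their converses; the lemma therefore serves
  both sides.
\<close>

lemma finite_generation_of_difunctional_subdirect:
  assumes algebras: "is_algebra S A" "is_algebra S B"
    and difunctional:
      "\<And>D. compatible S A B D \<Longrightarrow> D \<subseteq> carrier A \<times> carrier B \<Longrightarrow> D O D\<inverse> O D \<subseteq> D"
    and fin_gen: "fin_gen_algebra S A" "fin_gen_algebra S B"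
    and C: "Domain C = carrier A" "Range C = carrier B"
    and fin_gen_lambda: "fin_gen_congruence S B (C\<inverse> O C)"
  shows "\<exists>X. finite X \<and> X \<subseteq> C \<and> (\<forall>D. X \<subseteq> D \<longrightarrow> D \<subseteq> C \<longrightarrow> compatible S A B D \<longrightarrow> D = C)"
proof -
  have C_sub: "C \<subseteq> carrier A \<times> carrier B"
    using C by (auto simp: Domain_unfold Range_iff)
  obtain X\<^sub>A where X\<^sub>A: "finite X\<^sub>A" "X\<^sub>A \<subseteq> carrier A"
    "\<And>Y. X\<^sub>A \<subseteq> Y \<Longrightarrow> Y \<subseteq> carrier A \<Longrightarrow> closed_under_ops S A Y \<Longrightarrow> Y = carrier A"
    using fin_gen(1) unfolding fin_gen_algebra_iff[OF algebras(1)] by blast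
  obtain X\<^sub>B where X\<^sub>B: "finite X\<^sub>B" "X\<^sub>B \<subseteq> carrier B"
    "\<And>Y. X\<^sub>B \<subseteq> Y \<Longrightarrow> Y \<subseteq> carrier B \<Longrightarrow> closed_under_ops S B Y \<Longrightarrow> Y = carrier B"
    using fin_gen(2) unfolding fin_gen_algebra_iff[OF algebras(2)] by blast
  obtain R where R: "finite R" "R \<subseteq> carrier B \<times> carrier B"
    "C\<inverse> O C = congruence_generated S B R"
    using fin_gen_lambda unfolding fin_gen_congruence_def by blast
  have "R \<subseteq> C\<inverse> O C"
    unfolding R(3) congruence_generated_def by blast
  then have "\<forall>r\<in>R. \<exists>a. (a, fst r) \<in> C \<and> (a, snd r) \<in> C"
    by fastforce
  then obtain w where w: "\<And>r. r \<in> R \<Longrightarrow> (w r, fst r) \<in> C \<and> (w r, snd r) \<in> C"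
    by metis
  have "\<forall>a\<in>X\<^sub>A. \<exists>b. (a, b) \<in> C"
    using X\<^sub>A(2) C(1) by blast
  then obtain u where u: "\<And>a. a \<in> X\<^sub>A \<Longrightarrow> (a, u a) \<in> C"
    by metis
  have "\<forall>b\<in>X\<^sub>B. \<exists>a. (a, b) \<in> C"
    using X\<^sub>B(2) C(2) by blast
  then obtain v where v: "\<And>b. b \<in> X\<^sub>B \<Longrightarrow> (v b, b) \<in> C"
    by metis
  let ?X = "(\<lambda>a. (a, u a)) ` X\<^sub>A \<union> (\<lambda>b. (v b, b)) ` X\<^sub>B
    \<union> (\<lambda>r. (w r, fst r)) ` R \<union> (\<lambda>r. (w r, snd r)) ` R"
  have "D = C" if X: "?X \<subseteq> D" and "D \<subseteq> C" and D: "compatible S A B D" for D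
  proof
    have D_sub: "D \<subseteq> carrier A \<times> carrier B"
      using \<open>D \<subseteq> C\<close> C_sub by blast
    have dif: "D O D\<inverse> O D \<subseteq> D"
      using difunctional[OF D D_sub] .
    have "X\<^sub>A \<subseteq> Domain D"
      using X by blast
    then have Domain_D: "Domain D = carrier A"
      using D_sub by (intro X\<^sub>A(3) closed_under_ops_Domain[OF D]) auto
    have "X\<^sub>B \<subseteq> Range D"
      using X by blast
    then have "X\<^sub>B \<subseteq> Domain (D\<inverse>)"
      by simp
    then have "Domain (D\<inverse>) = carrier B"
      using D_sub by (intro X\<^sub>B(3) closed_under_ops_Domain[OF compatible_converse[OF D]]) auto
    then have "congruence S B (D\<inverse> O D)"
      using congruence_converse_relcomp[OF D D_sub _ dif] by simp
    moreover have "R \<subseteq> D\<inverse> O D"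
    proof
      fix r assume "r \<in> R"
      then have "(w r, fst r) \<in> D" "(w r, snd r) \<in> D"
        using X by blast+
      then have "(fst r, snd r) \<in> D\<inverse> O D"
        by blast
      then show "r \<in> D\<inverse> O D"
        by simp
    qed
    \<comment> \<open>\<open>C\<inverse> O C\<close> is the least congruence containing \<open>R\<close>.\<close>
    ultimately have lambda: "C\<inverse> O C \<subseteq> D\<inverse> O D"
      unfolding R(3) congruence_generated_def by blast
    show "C \<subseteq> D"
    proof (rule subrelI)
      fix a b assume ab: "(a, b) \<in> C"
      then obtain b' where b': "(a, b') \<in> D"
        using Domain_D C(1) by blast
      then have "(b', b) \<in> C\<inverse> O C"
        using ab \<open>D \<subseteq> C\<close> by blast
      then have "(b', b) \<in> D\<inverse> O D"
        using lambda by blast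
      then show "(a, b) \<in> D"
        using b' dif by blast
    qed
  qed (fact \<open>D \<subseteq> C\<close>)
  moreover have "finite ?X"
    using X\<^sub>A(1) X\<^sub>B(1) R(1) by simp
  moreover have "?X \<subseteq> C"
    using u v w by auto
  ultimately show ?thesis
    by (intro exI[of _ ?X] conjI allI impI)
qed

section \<open>Finite generation of subdirect products\<close>

theorem proposition3p3:
  fixes S :: "'f signature"
    and E :: "'f equations"
    and A :: "('f, 'a) algebra"
    and B :: "('f, 'b) algebra"
    and C :: "('f, 'a \<times> 'b) algebra"
  assumes "are_equations S E"
    and "congruence_permutable TYPE(('f, nat) trm set + 'a \<times> 'b) S E"
    and "in_variety S E A" and "in_variety S E B"
    and "fin_gen_algebra S A" and "fin_gen_algebra S B"
    and "subdirect_product S C A B"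
    and "fin_gen_congruence S B (lambda_snd S C) \<or> fin_gen_congruence S A (lambda_fst S C)"
  shows "fin_gen_algebra S C"
proof -
  let ?C = "carrier C"
  have algebras: "is_algebra S A" "is_algebra S B"
    using assms(3,4) by (simp_all add: in_variety_def)
  have C: "is_algebra S C" "?C \<subseteq> carrier A \<times> carrier B"
    and oper_C: "\<And>f xs. f \<in> ops S \<Longrightarrow> length xs = arity S f \<Longrightarrow> set xs \<subseteq> ?C \<Longrightarrow>
      oper C f xs = oper (prod_algebra A B) f xs"
    and surj: "fst ` ?C = carrier A" "snd ` ?C = carrier B"
    using assms(7) by (auto simp: subdirect_product_def subalgebra_def prod_algebra_def)
  have Domain_C: "Domain ?C = carrier A" and Range_C: "Range ?C = carrier B"
    using surj by (simp_all add: Domain_fst Range_snd)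
  have closed_iff: "closed_under_ops S C D \<longleftrightarrow> compatible S A B D" if "D \<subseteq> ?C" for D
  proof -
    have "oper C f xs = oper (prod_algebra A B) f xs"
      if "f \<in> ops S" "length xs = arity S f" "set xs \<subseteq> D" for f xs
      using oper_C that \<open>D \<subseteq> ?C\<close> by blast
    then show ?thesis
      by (simp add: compatible_iff_closed_under_ops closed_under_ops_def)
  qed
  have comp_C: "compatible S A B ?C"
    using closed_iff[of ?C] C(1) by (simp add: is_algebra_def)
  have homs: "homomorphism S C A fst" "homomorphism S C B snd"
    using C(2) by (auto simp: homomorphism_def oper_C prod_algebra_def)
  have difunctional: "D O D\<inverse> O D \<subseteq> D"
    if "compatible S A B D" "D \<subseteq> carrier A \<times> carrier B" for D
    using subalgebra_of_product_difunctional[OF assms(2-4) that] .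
  have converse_difunctional: "D O D\<inverse> O D \<subseteq> D"
    if "compatible S B A D" "D \<subseteq> carrier B \<times> carrier A" for D
    using difunctional[OF compatible_converse[OF that(1)]] that(2) by blast

  have image_snd: "image_relation snd (kernel_on C fst) = ?C\<inverse> O ?C"
    by (force simp: image_relation_def kernel_on_def)
  have "congruence S B (?C\<inverse> O ?C)"
    using congruence_converse_relcomp[OF comp_C C(2) Range_C difunctional[OF comp_C C(2)]] .
  then have lambda_snd: "lambda_snd S C = ?C\<inverse> O ?C"
    using image_relation_congruence_join_kernel_on[OF C(1) homs(2), of "kernel_on C fst"]
    unfolding lambda_snd_def image_snd by (auto simp: kernel_on_def)

  have conv: "compatible S B A (?C\<inverse>)" "?C\<inverse> \<subseteq> carrier B \<times> carrier A"
    "Range (?C\<inverse>) = carrier A" "Domain (?C\<inverse>) = carrier B"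
    using compatible_converse[OF comp_C] C(2) Domain_C Range_C by auto
  have image_fst: "image_relation fst (kernel_on C snd) = (?C\<inverse>)\<inverse> O ?C\<inverse>"
    by (force simp: image_relation_def kernel_on_def)
  have "congruence S A ((?C\<inverse>)\<inverse> O ?C\<inverse>)"
    using congruence_converse_relcomp[OF conv(1-3) converse_difunctional[OF conv(1,2)]] .
  then have lambda_fst: "lambda_fst S C = (?C\<inverse>)\<inverse> O ?C\<inverse>"
    using image_relation_congruence_join_kernel_on[OF C(1) homs(1), of "kernel_on C snd"]
    unfolding lambda_fst_def image_fst congruence_join_def
      Un_commute[of "kernel_on C fst"] by (auto simp: kernel_on_def)

  have "\<exists>X. finite X \<and> X \<subseteq> ?C \<and> (\<forall>D. X \<subseteq> D \<longrightarrow> D \<subseteq> ?C \<longrightarrow> compatible S A B D \<longrightarrow> D = ?C)"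
    using assms(8)
  proof
    assume "fin_gen_congruence S B (lambda_snd S C)"
    then show ?thesis
      using finite_generation_of_difunctional_subdirect[OF algebras difunctional
          assms(5,6) Domain_C Range_C]
      unfolding lambda_snd by blast
  next
    assume "fin_gen_congruence S A (lambda_fst S C)"
    then obtain X where X: "finite X" "X \<subseteq> ?C\<inverse>"
      "\<And>D. X \<subseteq> D \<Longrightarrow> D \<subseteq> ?C\<inverse> \<Longrightarrow> compatible S B A D \<Longrightarrow> D = ?C\<inverse>"
      using finite_generation_of_difunctional_subdirect[OF algebras(2,1) converse_difunctional
          assms(6,5) conv(4,3)]
      unfolding lambda_fst by blast
    have "D = ?C" if "X\<inverse> \<subseteq> D" "D \<subseteq> ?C" "compatible S A B D" for D
    proof -
      have "D\<inverse> = ?C\<inverse>"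
        using that by (intro X(3) compatible_converse) auto
      then show ?thesis
        by simp
    qed
    then show ?thesis
      using X(1,2) by (intro exI[of _ "X\<inverse>"]) auto
  qed
  then show ?thesis
    by (simp add: fin_gen_algebra_iff[OF C(1)] closed_iff cong: imp_cong)
qed

end
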